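(* Let $G$ be a graph with $|E(G)|\ge |V(G)|$. If $G$ is a super edge-magic graph of girth $g(G)\ge 4$, then $3+|E(G)|+|V(G)|$ is not the valence of any super edge-magic labeling of $G$.
   Context: Graphs are finite and simple. The notation $[a,b]$ denotes the set of integers $x$ with $a\le x\le b$. An edge-magic labeling of a graph $G$ is a bijection $f:V(G)\cup E(G)\to[1,|V(G)|+|E(G)|]$ such that $f(u)+f(v)+f(uv)$ equals a constant (the valence $\mathrm{val}(f)$ of $f$) for every $uv\in E(G)$. It is super edge-magic if moreover $f(V(G))=[1,|V(G)|]$, and $G$ is super edge-magic if it admits a super edge-magic labeling. The girth of a graph is the length of its shortest cycle. *)

theory Defs
  imports Main "HOL-Library.Extended_Nat"
begin

text \<open>A finite simple graph is given by its vertex set and its set of edges, an edge being a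
  two-element set of vertices. As usual, the vertex set of a graph is nonempty.\<close>

definition simple_graph :: "'a set \<Rightarrow> 'a set set \<Rightarrow> bool" where
  "simple_graph V E \<longleftrightarrow> finite V \<and> V \<noteq> {} \<and> (\<forall>e\<in>E. e \<subseteq> V \<and> card e = 2)"

text \<open>A cycle is represented by the list of its distinct vertices in cyclic order, so its length
  is the length of the list.\<close>

definition is_cycle :: "'a set set \<Rightarrow> 'a list \<Rightarrow> bool" where
  "is_cycle E vs \<longleftrightarrow> length vs \<ge> 3 \<and> distinct vs \<and>
     (\<forall>i < length vs. {vs ! i, vs ! (Suc i mod length vs)} \<in> E)"

text \<open>The infimum over the empty set is \<open>\<infinity>\<close>, so acyclic graphs have infinite girth.\<close>

definition girth :: "'a set set \<Rightarrow> enat" where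
  "girth E = (INF vs\<in>{vs. is_cycle E vs}. enat (length vs))"

text \<open>A labeling of \<open>V \<union> E\<close> is a function on the sum type: \<open>f (Inl v)\<close> is the label of the
  vertex \<open>v\<close> and \<open>f (Inr e)\<close> is the label of the edge \<open>e\<close>.\<close>

definition is_magic_constant :: "'a set set \<Rightarrow> ('a + 'a set \<Rightarrow> nat) \<Rightarrow> nat \<Rightarrow> bool" where
  "is_magic_constant E f k \<longleftrightarrow>
     (\<forall>u v. {u, v} \<in> E \<longrightarrow> f (Inl u) + f (Inl v) + f (Inr {u, v}) = k)"

definition edge_magic_labeling :: "'a set \<Rightarrow> 'a set set \<Rightarrow> ('a + 'a set \<Rightarrow> nat) \<Rightarrow> bool" where
  "edge_magic_labeling V E f \<longleftrightarrow>
     bij_betw f (V <+> E) {1..card V + card E} \<and> (\<exists>k. is_magic_constant E f k)"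

text \<open>The constant is uniquely determined as soon as \<open>E\<close> is nonempty.\<close>

definition valence :: "'a set set \<Rightarrow> ('a + 'a set \<Rightarrow> nat) \<Rightarrow> nat" where
  "valence E f = (THE k. is_magic_constant E f k)"

definition super_edge_magic_labeling ::
    "'a set \<Rightarrow> 'a set set \<Rightarrow> ('a + 'a set \<Rightarrow> nat) \<Rightarrow> bool" where
  "super_edge_magic_labeling V E f \<longleftrightarrow>
     edge_magic_labeling V E f \<and> f ` Inl ` V = {1..card V}"

definition super_edge_magic :: "'a set \<Rightarrow> 'a set set \<Rightarrow> bool" where
  "super_edge_magic V E \<longleftrightarrow> (\<exists>f. super_edge_magic_labeling V E f)"

end

theory Submission
  imports Defs
begin

text \<open>With valence \<open>3 + |E| + |V|\<close> the induced edge sums are exactly \<open>3, \<dots>, |E| + 2\<close>.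
  Identify vertices with their labels. In a triangle-free graph, induction on \<open>k\<close> shows that
  the sum \<open>k + 1\<close> can only be realised by the edge \<open>{1, k}\<close>: any other edge with this sum joins two
  earlier neighbours of \<open>1\<close>. So \<open>1\<close> is adjacent to all other vertices, and the edge realising
  the sum \<open>|V| + 2\<close>, which avoids \<open>1\<close>, closes a triangle.\<close>

lemma girth_le_3_if_triangle:
  assumes "{a, b} \<in> E" "{b, c} \<in> E" "{c, a} \<in> E" "distinct [a, b, c]"
  shows "girth E \<le> 3"
proof -
  have "{[a, b, c] ! i, [a, b, c] ! (Suc i mod 3)} \<in> E" if "i < 3" for i
  proof -
    have "i = 0 \<or> i = 1 \<or> i = 2" using that by linarith
    then show ?thesis using assms by auto
  qed
  then have "is_cycle E [a, b, c]"
    using assms(4) by (simp add: is_cycle_def)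
  then have "girth E \<le> enat (length [a, b, c])"
    unfolding girth_def by (intro INF_lower) simp
  then show ?thesis by (simp add: numeral_eq_enat numeral_3_eq_3)
qed

text \<open>Any two magic constants agree on the given edge, so the \<open>THE\<close> in
  \<open>valence\<close> picks out \<open>k\<close>. For empty \<open>E\<close> every number would
  qualify.\<close>

lemma is_magic_constant_valence:
  assumes "is_magic_constant E f k" "{u, v} \<in> E"
  shows "is_magic_constant E f (valence E f)"
proof -
  have "j = k" if "is_magic_constant E f j" for j
    using assms that unfolding is_magic_constant_def by metis
  then show ?thesis
    unfolding valence_def using assms(1) by (metis theI)
qed

lemma simple_graph_edgeE:
  assumes "simple_graph V E" "e \<in> E"
  obtains a b where "e = {a, b}" "a \<in> V" "b \<in> V" "a \<noteq> b"
proof -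
  have "e \<subseteq> V" "card e = 2"
    using assms by (auto simp: simple_graph_def)
  then show ?thesis
    using that by (auto simp: card_2_iff)
qed

text \<open>The edge with label \<open>3 + card E + card V - s\<close> has end sum \<open>s\<close>;
  the bounds on \<open>s\<close> are what makes this number an edge label.\<close>

lemma super_edge_magic_edge_sum:
  assumes G: "simple_graph V E" and f: "super_edge_magic_labeling V E f"
    and val: "valence E f = 3 + card E + card V"
    and s: "3 \<le> s" "s \<le> card E + 2"
  obtains a b where "a \<in> V" "b \<in> V" "a \<noteq> b" "{a, b} \<in> E" "f (Inl a) + f (Inl b) = s"
proof -
  have bij: "bij_betw f (V <+> E) {1..card V + card E}"
    and img: "f ` Inl ` V = {1..card V}"
    using f by (auto simp: super_edge_magic_labeling_def edge_magic_labeling_def)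
  have "3 + card E + card V - s \<in> {1..card V + card E}"
    using s by auto
  then obtain x where x: "x \<in> V <+> E" "f x = 3 + card E + card V - s"
    using bij by (metis bij_betw_imp_surj_on imageE)
  \<comment> \<open>As \<open>s \<le> card E + 2\<close>, the label is at least
    \<open>card V + 1\<close>, hence not one of the vertex labels
    \<open>1, \<dots>, card V\<close>.\<close>
  have "f x > card V"
    using x(2) s by linarith
  then have "x \<notin> Inl ` V"
    using img by (metis atLeastAtMost_iff imageI not_le)
  then obtain e where e: "e \<in> E" "x = Inr e"
    using x(1) by auto
  obtain a b where ab: "e = {a, b}" "a \<in> V" "b \<in> V" "a \<noteq> b"
    using simple_graph_edgeE[OF G e(1)] .
  have "is_magic_constant E f (3 + card E + card V)"
    using f val is_magic_constant_valence e(1) ab(1)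
    unfolding super_edge_magic_labeling_def edge_magic_labeling_def by metis
  then have "f (Inl a) + f (Inl b) + f x = 3 + card E + card V"
    using e ab(1) by (simp add: is_magic_constant_def)
  then have "f (Inl a) + f (Inl b) = s"
    using x(2) s by linarith
  with ab e(1) that show ?thesis by blast
qed

theorem theorem2p5:
  fixes V :: "'a set" and E :: "'a set set"
  assumes "simple_graph V E"
    and "card E \<ge> card V"
    and "super_edge_magic V E"
    and "girth E \<ge> 4"
  shows "\<not> (\<exists>f. super_edge_magic_labeling V E f \<and> valence E f = 3 + card E + card V)"
proof
  assume "\<exists>f. super_edge_magic_labeling V E f \<and> valence E f = 3 + card E + card V"
  then obtain f where f: "super_edge_magic_labeling V E f"
    and val: "valence E f = 3 + card E + card V"
    by blast
  define l where "l v = f (Inl v)" for v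
  have "inj_on f (V <+> E)"
    using f by (auto simp: super_edge_magic_labeling_def edge_magic_labeling_def bij_betw_def)
  then have inj: "a = b" if "l a = l b" "a \<in> V" "b \<in> V" for a b
    using that unfolding l_def inj_on_def by blast
  have img: "l ` V = {1..card V}"
    using f by (simp add: super_edge_magic_labeling_def l_def image_image)
  have range: "1 \<le> l v" "l v \<le> card V" if "v \<in> V" for v
    using img that by auto
  have V: "card V \<ge> 1"
    using assms(1) by (simp add: simple_graph_def Suc_le_eq card_gt_0_iff)
  then obtain u where u: "u \<in> V" "l u = 1"
    using img by (metis atLeastAtMost_iff imageE order_refl)
  have sumE: "\<exists>a\<in>V. \<exists>b\<in>V. a \<noteq> b \<and> {a, b} \<in> E \<and> l a + l b = s"
    if "3 \<le> s" "s \<le> card E + 2" for s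
    using super_edge_magic_edge_sum[OF assms(1) f val that] unfolding l_def by metis
  \<comment> \<open>The conditions \<open>l a \<noteq> 1\<close> and \<open>l b \<noteq> 1\<close>
    keep \<open>a\<close> and \<open>b\<close> apart from \<open>u\<close>.\<close>
  have no_triangle: False
    if "{u, a} \<in> E" "{u, b} \<in> E" "{a, b} \<in> E" "a \<noteq> b" "l a \<noteq> 1" "l b \<noteq> 1" for a b
  proof -
    have "girth E \<le> 3"
      using that u(2) by (intro girth_le_3_if_triangle[of u a E b]) (auto simp: insert_commute)
    then have "(4::enat) \<le> 3"
      using assms(4) order_trans by blast
    then show False by simp
  qed
  have star: "{u, w} \<in> E" if "w \<in> V" "l w \<noteq> 1" for w
    using that
  proof (induction "l w" arbitrary: w rule: less_induct)
    case less
    have "3 \<le> l w + 1" "l w + 1 \<le> card E + 2"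
      using less.prems range[of w] assms(2) by auto
    then obtain a b where ab: "a \<in> V" "b \<in> V" "a \<noteq> b" "{a, b} \<in> E" "l a + l b = l w + 1"
      using sumE by metis
    consider "l a = 1" | "l b = 1" | "l a \<noteq> 1" "l b \<noteq> 1" by blast
    then show ?case
    proof cases
      case 1
      then have "a = u" "b = w" using ab u less.prems inj by auto
      then show ?thesis using ab by simp
    next
      case 2
      then have "b = u" "a = w" using ab u less.prems inj by auto
      then show ?thesis using ab by (simp add: insert_commute)
    next
      case 3
      \<comment> \<open>Both labels are at least 2 and add up to \<open>l w + 1\<close>. By
        induction \<open>u\<close> is then adjacent to both \<open>a\<close> and
        \<open>b\<close>.\<close>
      then have "l a < l w" "l b < l w" using ab range[of a] range[of b] by auto
      then show ?thesis using less.hyps no_triangle ab 3 by blast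
    qed
  qed
  \<comment> \<open>The sum \<open>card V + 2\<close> is realised because
    \<open>card V \<le> card E\<close>. It is too large for an edge at \<open>u\<close>, whose other
    end would need the label \<open>card V + 1\<close>.\<close>
  obtain a b where ab: "a \<in> V" "b \<in> V" "a \<noteq> b" "{a, b} \<in> E" "l a + l b = card V + 2"
    using sumE[of "card V + 2"] V assms(2) by auto
  then have "l a \<noteq> 1" "l b \<noteq> 1" using range[of a] range[of b] by auto
  then show False using ab star no_triangle by blast
qed

end
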